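(* The type $Id=\forall X\{X\to X\}$ is an $I$-type of order $1$.
   Context: $\lambda$-terms are untyped; $(t)u$ denotes application. The set of $\lambda I$-terms is defined inductively: variables are $\lambda I$-terms; if $u,v$ are $\lambda I$-terms so is $(u)v$; if $u$ is a $\lambda I$-term and $x$ is free in $u$ then $\lambda x\,u$ is a $\lambda I$-term. System $\mathcal{F}$ (Curry style). Types are built from type variables $X,Y,\dots$ by $E\to F$ and $\forall X\,E$, and are identified up to renaming of bound variables. Typing rules: (ax) $x_1:A_1,\dots,x_n:A_n\vdash x_i:A_i$; ($\to_i$) from $\Gamma,x:A\vdash t:B$ infer $\Gamma\vdash\lambda x\,t:A\to B$; ($\to_e$) from $\Gamma\vdash u:A\to B$ and $\Gamma\vdash v:A$ infer $\Gamma\vdash (u)v:B$; ($\forall_i$) from $\Gamma\vdash t:A$ with $X$ not free in $\Gamma$ infer $\Gamma\vdash t:\forall X A$; ($\forall_e$) from $\Gamma\vdash t:\forall XA$ infer $\Gamma\vdash t:A[G/X]$ for any type $G$. Derivability is written $\Gamma\vdash_{\mathcal F}t:A$. Standing convention: only proper types are used, also inside derivations; a type is proper if for each of its subtypes $\forall X E$ the variable $X$ is free in $E$. A closed type $D$ is an $I$-type if every closed $\beta$-normal $\lambda$-term $t$ with $\vdash_{\mathcal F}t:D$ is a $\lambda I$-term. Let $\Lambda(D)$ be the set of closed $\beta\eta$-normal $\lambda$-terms $t$ (up to $\alpha$-equivalence) with $\vdash_{\mathcal F}t:D$. An $I$-type $D$ is of order $n\in\mathbb{N}$ if $\mathrm{Card}(\Lambda(D))=n$.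 *)

theory Defs
  imports Main
begin

text \<open>
  Terms and types are in de Bruijn notation, so that \<open>\<alpha>\<close>-equivalence of terms and renaming of bound
  variables in types are both equality.
\<close>

datatype trm = Var nat | App trm trm | Lam trm

datatype ty = TVar nat | Arr ty ty (infixr "\<rightarrow>\<^sub>t" 65) | All ty


subsection \<open>Terms\<close>

fun free_in :: "nat \<Rightarrow> trm \<Rightarrow> bool" where
  "free_in k (Var i) \<longleftrightarrow> i = k"
| "free_in k (App u v) \<longleftrightarrow> free_in k u \<or> free_in k v"
| "free_in k (Lam u) \<longleftrightarrow> free_in (Suc k) u"

definition closed_trm :: "trm \<Rightarrow> bool" where
  "closed_trm t \<longleftrightarrow> (\<forall>k. \<not> free_in k t)"

inductive lambda_I :: "trm \<Rightarrow> bool" where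
  "lambda_I (Var i)"
| "lambda_I u \<Longrightarrow> lambda_I v \<Longrightarrow> lambda_I (App u v)"
| "lambda_I u \<Longrightarrow> free_in 0 u \<Longrightarrow> lambda_I (Lam u)"

fun lift :: "nat \<Rightarrow> trm \<Rightarrow> trm" where
  "lift k (Var i) = (if i < k then Var i else Var (Suc i))"
| "lift k (App u v) = App (lift k u) (lift k v)"
| "lift k (Lam u) = Lam (lift (Suc k) u)"

text \<open>\<open>subst k s t\<close> replaces the variable \<open>k\<close> of \<open>t\<close> by \<open>s\<close> and decrements the larger ones, the
  binder of \<open>k\<close> being removed.\<close>

fun subst :: "nat \<Rightarrow> trm \<Rightarrow> trm \<Rightarrow> trm" where
  "subst k s (Var i) = (if i < k then Var i else if i = k then s else Var (i - 1))"
| "subst k s (App u v) = App (subst k s u) (subst k s v)"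
| "subst k s (Lam u) = Lam (subst (Suc k) (lift 0 s) u)"

inductive beta :: "trm \<Rightarrow> trm \<Rightarrow> bool" (infix "\<rightarrow>\<^sub>\<beta>" 50) where
  "App (Lam u) v \<rightarrow>\<^sub>\<beta> subst 0 v u"
| "u \<rightarrow>\<^sub>\<beta> u' \<Longrightarrow> App u v \<rightarrow>\<^sub>\<beta> App u' v"
| "v \<rightarrow>\<^sub>\<beta> v' \<Longrightarrow> App u v \<rightarrow>\<^sub>\<beta> App u v'"
| "u \<rightarrow>\<^sub>\<beta> u' \<Longrightarrow> Lam u \<rightarrow>\<^sub>\<beta> Lam u'"

text \<open>In the \<open>\<eta>\<close>-redex, \<open>lift 0 u\<close> is \<open>u\<close> below a binder whose variable does not occur in it.\<close>

inductive eta :: "trm \<Rightarrow> trm \<Rightarrow> bool" (infix "\<rightarrow>\<^sub>\<eta>" 50) where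
  "Lam (App (lift 0 u) (Var 0)) \<rightarrow>\<^sub>\<eta> u"
| "u \<rightarrow>\<^sub>\<eta> u' \<Longrightarrow> App u v \<rightarrow>\<^sub>\<eta> App u' v"
| "v \<rightarrow>\<^sub>\<eta> v' \<Longrightarrow> App u v \<rightarrow>\<^sub>\<eta> App u v'"
| "u \<rightarrow>\<^sub>\<eta> u' \<Longrightarrow> Lam u \<rightarrow>\<^sub>\<eta> Lam u'"

definition beta_normal :: "trm \<Rightarrow> bool" where
  "beta_normal t \<longleftrightarrow> \<not> (\<exists>u. t \<rightarrow>\<^sub>\<beta> u)"

definition beta_eta_normal :: "trm \<Rightarrow> bool" where
  "beta_eta_normal t \<longleftrightarrow> \<not> (\<exists>u. t \<rightarrow>\<^sub>\<beta> u \<or> t \<rightarrow>\<^sub>\<eta> u)"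


subsection \<open>Types\<close>

fun tfree_in :: "nat \<Rightarrow> ty \<Rightarrow> bool" where
  "tfree_in k (TVar i) \<longleftrightarrow> i = k"
| "tfree_in k (E \<rightarrow>\<^sub>t F) \<longleftrightarrow> tfree_in k E \<or> tfree_in k F"
| "tfree_in k (All E) \<longleftrightarrow> tfree_in (Suc k) E"

definition closed_ty :: "ty \<Rightarrow> bool" where
  "closed_ty A \<longleftrightarrow> (\<forall>k. \<not> tfree_in k A)"

fun proper :: "ty \<Rightarrow> bool" where
  "proper (TVar i) \<longleftrightarrow> True"
| "proper (E \<rightarrow>\<^sub>t F) \<longleftrightarrow> proper E \<and> proper F"
| "proper (All E) \<longleftrightarrow> tfree_in 0 E \<and> proper E"

fun tlift :: "nat \<Rightarrow> ty \<Rightarrow> ty" where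
  "tlift k (TVar i) = (if i < k then TVar i else TVar (Suc i))"
| "tlift k (E \<rightarrow>\<^sub>t F) = tlift k E \<rightarrow>\<^sub>t tlift k F"
| "tlift k (All E) = All (tlift (Suc k) E)"

fun tsubst :: "nat \<Rightarrow> ty \<Rightarrow> ty \<Rightarrow> ty" where
  "tsubst k G (TVar i) = (if i < k then TVar i else if i = k then G else TVar (i - 1))"
| "tsubst k G (E \<rightarrow>\<^sub>t F) = tsubst k G E \<rightarrow>\<^sub>t tsubst k G F"
| "tsubst k G (All E) = All (tsubst (Suc k) (tlift 0 G) E)"


subsection \<open>System F, Curry style, restricted to proper types\<close>

text \<open>
  The \<open>i\<close>-th entry of the context types the variable \<open>i\<close>.  In \<open>all_i\<close> the lifted context is one in
  which the type variable to be bound is not free.  Properness is required where a rule introduces a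
  type; that every type of a derivation is then proper is \<open>typing_proper\<close> below.
\<close>

inductive typing :: "ty list \<Rightarrow> trm \<Rightarrow> ty \<Rightarrow> bool" ("_ \<turnstile>\<^sub>F _ : _" [50, 50, 50] 50) where
  ax: "\<forall>A \<in> set \<Gamma>. proper A \<Longrightarrow> i < length \<Gamma> \<Longrightarrow> \<Gamma> \<turnstile>\<^sub>F Var i : \<Gamma> ! i"
| arr_i: "A # \<Gamma> \<turnstile>\<^sub>F t : B \<Longrightarrow> \<Gamma> \<turnstile>\<^sub>F Lam t : A \<rightarrow>\<^sub>t B"
| arr_e: "\<Gamma> \<turnstile>\<^sub>F u : A \<rightarrow>\<^sub>t B \<Longrightarrow> \<Gamma> \<turnstile>\<^sub>F v : A \<Longrightarrow> \<Gamma> \<turnstile>\<^sub>F App u v : B"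
| all_i: "map (tlift 0) \<Gamma> \<turnstile>\<^sub>F t : A \<Longrightarrow> proper (All A) \<Longrightarrow> \<Gamma> \<turnstile>\<^sub>F t : All A"
| all_e: "\<Gamma> \<turnstile>\<^sub>F t : All A \<Longrightarrow> proper G \<Longrightarrow> \<Gamma> \<turnstile>\<^sub>F t : tsubst 0 G A"

lemma tfree_in_tlift:
  "tfree_in j (tlift k A) \<longleftrightarrow> (if j < k then tfree_in j A else j \<noteq> k \<and> tfree_in (j - 1) A)"
  by (induction A arbitrary: j k) (auto split: if_splits simp: Suc_diff_le)

lemma proper_tlift [simp]: "proper (tlift k A) \<longleftrightarrow> proper A"
  by (induction A arbitrary: k) (auto simp: tfree_in_tlift)

lemma tfree_in_tsubst: "tfree_in j A \<Longrightarrow> j < k \<Longrightarrow> tfree_in j (tsubst k G A)"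
  by (induction A arbitrary: j k G) auto

lemma proper_tsubst: "proper A \<Longrightarrow> proper G \<Longrightarrow> proper (tsubst k G A)"
  by (induction A arbitrary: k G) (auto simp: tfree_in_tsubst)

lemma typing_proper: "\<Gamma> \<turnstile>\<^sub>F t : A \<Longrightarrow> (\<forall>B \<in> set \<Gamma>. proper B) \<and> proper A"
  by (induction rule: typing.induct) (auto simp: proper_tsubst)


subsection \<open>I-types and their order\<close>

definition I_type :: "ty \<Rightarrow> bool" where
  "I_type D \<longleftrightarrow> proper D \<and> closed_ty D \<and>
     (\<forall>t. closed_trm t \<and> beta_normal t \<and> ([] \<turnstile>\<^sub>F t : D) \<longrightarrow> lambda_I t)"

definition Lambda_set :: "ty \<Rightarrow> trm set" where
  "Lambda_set D = {t. closed_trm t \<and> beta_eta_normal t \<and> ([] \<turnstile>\<^sub>F t : D)}"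

definition I_type_of_order :: "ty \<Rightarrow> nat \<Rightarrow> bool" where
  "I_type_of_order D n \<longleftrightarrow> I_type D \<and> finite (Lambda_set D) \<and> card (Lambda_set D) = n"

definition Id_type :: ty where
  "Id_type = All (TVar 0 \<rightarrow>\<^sub>t TVar 0)"

end

theory Submission
  imports Defs
begin

text \<open>
  Types are interpreted as sets of terms closed under weak head expansion, quantifiers as
  intersections over all such sets; typable terms lie in the interpretation of their types.
  Interpreting \<open>X\<close> as the set of terms whose weak head reduction reaches a variable \<open>x\<close>, a term \<open>t\<close>
  of type \<open>\<forall>X. X \<rightarrow> X\<close> has the property that \<open>(t)x\<close> reaches \<open>x\<close>.  If \<open>t\<close> is \<open>\<beta>\<close>-normal, the only
  reduction step available is the contraction of \<open>(t)x\<close> itself, which forces \<open>t = \<lambda>x x\<close>.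
\<close>

text \<open>Simultaneous substitution: \<open>adequacy\<close> has to instantiate all context
  variables at once, because the context grows when an abstraction is typed.\<close>

fun psubst :: "(nat \<Rightarrow> trm) \<Rightarrow> trm \<Rightarrow> trm" where
  "psubst \<sigma> (Var i) = \<sigma> i"
| "psubst \<sigma> (App u v) = App (psubst \<sigma> u) (psubst \<sigma> v)"
| "psubst \<sigma> (Lam u) = Lam (psubst (case_nat (Var 0) (\<lambda>i. lift 0 (\<sigma> i))) u)"

lemma psubst_Var [simp]: "psubst Var t = t"
proof (induction t)
  case (Lam t)
  have "case_nat (Var 0) (\<lambda>i. lift 0 (Var i)) = Var"
    by (auto simp: fun_eq_iff split: nat.split)
  with Lam show ?case by simp
qed simp_all

lemma lift_lift: "j \<le> k \<Longrightarrow> lift j (lift k t) = lift (Suc k) (lift j t)"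
  by (induction t arbitrary: j k) auto

lemma subst_lift [simp]: "subst k s (lift k t) = t"
  by (induction t arbitrary: k s) auto

lemma subst_lift_le: "j \<le> k \<Longrightarrow> subst (Suc k) (lift j s) (lift j t) = lift j (subst k s t)"
proof (induction t arbitrary: j k s)
  case (Lam t)
  then show ?case by (simp add: lift_lift)
qed auto

lemma subst_psubst: "subst k s (psubst \<sigma> t) = psubst (\<lambda>i. subst k s (\<sigma> i)) t"
proof (induction t arbitrary: k s \<sigma>)
  case (Lam t)
  have "(\<lambda>i. subst (Suc k) (lift 0 s) (case_nat (Var 0) (\<lambda>i. lift 0 (\<sigma> i)) i))
      = case_nat (Var 0) (\<lambda>i. lift 0 (subst k s (\<sigma> i)))"
    by (auto simp: fun_eq_iff subst_lift_le split: nat.split)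
  with Lam show ?case by simp
qed simp_all

text \<open>Computes the contractum of \<open>App (psubst \<sigma> (Lam t)) v\<close>: the argument
  becomes the value of index 0 and the lifts introduced by the binder cancel.\<close>

lemma subst_psubst_under_binder:
  "subst 0 v (psubst (case_nat (Var 0) (\<lambda>i. lift 0 (\<sigma> i))) t) = psubst (case_nat v \<sigma>) t"
proof -
  have "(\<lambda>i. subst 0 v (case_nat (Var 0) (\<lambda>i. lift 0 (\<sigma> i)) i)) = case_nat v \<sigma>"
    by (auto simp: fun_eq_iff split: nat.split)
  then show ?thesis by (simp add: subst_psubst)
qed

text \<open>Such a substitution only decrements the indices above \<open>k\<close>, and none of them
  occurs free.\<close>

lemma subst_same_Var: "(\<And>i. k < i \<Longrightarrow> \<not> free_in i t) \<Longrightarrow> subst k (Var k) t = t"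
proof (induction t arbitrary: k)
  case (Var i)
  then show ?case by (auto simp: not_less_iff_gr_or_eq)
next
  case (Lam t)
  have "\<not> free_in i t" if "Suc k < i" for i
    using Lam.prems[of "i - 1"] that by (cases i) auto
  with Lam.IH show ?case by simp
qed auto

inductive whead :: "trm \<Rightarrow> trm \<Rightarrow> bool" where
  whead_beta: "whead (App (Lam u) v) (subst 0 v u)"
| whead_App: "whead u u' \<Longrightarrow> whead (App u v) (App u' v)"

lemma whead_imp_beta: "whead t u \<Longrightarrow> t \<rightarrow>\<^sub>\<beta> u"
  by (induction rule: whead.induct) (auto intro: beta.intros)

definition saturated :: "trm set \<Rightarrow> bool" where
  "saturated S \<longleftrightarrow> (\<forall>t u. whead t u \<longrightarrow> u \<in> S \<longrightarrow> t \<in> S)"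

fun interp :: "(nat \<Rightarrow> trm set) \<Rightarrow> ty \<Rightarrow> trm set" where
  "interp \<rho> (TVar i) = \<rho> i"
| "interp \<rho> (A \<rightarrow>\<^sub>t B) = {t. \<forall>v \<in> interp \<rho> A. App t v \<in> interp \<rho> B}"
| "interp \<rho> (All A) = {t. \<forall>S. saturated S \<longrightarrow> t \<in> interp (case_nat S \<rho>) A}"

lemma saturatedI: "(\<And>t u. whead t u \<Longrightarrow> u \<in> S \<Longrightarrow> t \<in> S) \<Longrightarrow> saturated S"
  unfolding saturated_def by blast

lemma saturatedD: "saturated S \<Longrightarrow> whead t u \<Longrightarrow> u \<in> S \<Longrightarrow> t \<in> S"
  unfolding saturated_def by blast

text \<open>A weak head step from \<open>t\<close> to \<open>u\<close> is also one from
  \<open>App t v\<close> to \<open>App u v\<close>, so an arrow inherits saturation from its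
  codomain; a quantifier inherits it as an intersection.\<close>

lemma saturated_interp: "\<forall>i. saturated (\<rho> i) \<Longrightarrow> saturated (interp \<rho> A)"
proof (induction A arbitrary: \<rho>)
  case (TVar i)
  then show ?case by simp
next
  case (Arr A B)
  have "saturated (interp \<rho> B)" using Arr.prems by (rule Arr.IH(2))
  then show ?case
    unfolding saturated_def interp.simps using whead_App by blast
next
  case (All A)
  show ?case
  proof (rule saturatedI)
    fix t u
    assume "whead t u" and u: "u \<in> interp \<rho> (All A)"
    have "t \<in> interp (case_nat S \<rho>) A" if S: "saturated S" for S
    proof -
      have "\<forall>i. saturated (case_nat S \<rho> i)"
        using S All.prems by (simp split: nat.split)
      then have "saturated (interp (case_nat S \<rho>) A)" by (rule All.IH)
      moreover have "u \<in> interp (case_nat S \<rho>) A" using u S by simp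
      ultimately show ?thesis using \<open>whead t u\<close> by (blast intro: saturatedD)
    qed
    then show "t \<in> interp \<rho> (All A)" by simp
  qed
qed

lemma interp_tlift: "interp \<rho> (tlift k A) = interp (\<lambda>i. if i < k then \<rho> i else \<rho> (Suc i)) A"
proof (induction A arbitrary: \<rho> k)
  case (All A)
  have "(\<lambda>i. if i < Suc k then case_nat S \<rho> i else case_nat S \<rho> (Suc i))
      = case_nat S (\<lambda>i. if i < k then \<rho> i else \<rho> (Suc i))" for S
    by (auto simp: fun_eq_iff split: nat.split)
  with All show ?case by simp
qed auto

lemma interp_tlift_case_nat [simp]: "interp (case_nat S \<rho>) (tlift 0 A) = interp \<rho> A"
  by (simp add: interp_tlift)

text \<open>Substitution in types is insertion into the environment. The index \<open>k\<close> is
  general because each quantifier crossed puts a set \<open>S\<close> in front, which the lifted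
  \<open>G\<close> does not see.\<close>

lemma interp_tsubst:
  "interp \<rho> (tsubst k G A)
    = interp (\<lambda>i. if i < k then \<rho> i else if i = k then interp \<rho> G else \<rho> (i - 1)) A"
proof (induction A arbitrary: \<rho> k G)
  case (All A)
  have "(\<lambda>i. if i < Suc k then case_nat S \<rho> i
             else if i = Suc k then interp (case_nat S \<rho>) (tlift 0 G) else case_nat S \<rho> (i - 1))
      = case_nat S (\<lambda>i. if i < k then \<rho> i else if i = k then interp \<rho> G else \<rho> (i - 1))" for S
    by (auto simp: fun_eq_iff split: nat.split)
  with All show ?case by simp
qed auto

lemma interp_tsubst_0: "interp \<rho> (tsubst 0 G A) = interp (case_nat (interp \<rho> G) \<rho>) A"
proof -
  have "(\<lambda>i. if i < 0 then \<rho> i else if i = 0 then interp \<rho> G else \<rho> (i - 1))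
      = case_nat (interp \<rho> G) \<rho>"
    by (auto simp: fun_eq_iff split: nat.split)
  then show ?thesis by (simp add: interp_tsubst)
qed

text \<open>Both \<open>\<rho>\<close> and \<open>\<sigma>\<close> vary in the induction:
  \<open>arr_i\<close> extends \<open>\<sigma>\<close> by the argument, \<open>all_i\<close> extends
  \<open>\<rho>\<close> by a saturated set.\<close>

lemma adequacy:
  assumes "\<Gamma> \<turnstile>\<^sub>F t : A" and "\<forall>i. saturated (\<rho> i)"
    and "\<forall>i < length \<Gamma>. \<sigma> i \<in> interp \<rho> (\<Gamma> ! i)"
  shows "psubst \<sigma> t \<in> interp \<rho> A"
  using assms
proof (induction arbitrary: \<rho> \<sigma> rule: typing.induct)
  case (arr_i A \<Gamma> t B)
  have "App (psubst \<sigma> (Lam t)) v \<in> interp \<rho> B" if v: "v \<in> interp \<rho> A" for v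
  proof -
    have "\<forall>i < length (A # \<Gamma>). case_nat v \<sigma> i \<in> interp \<rho> ((A # \<Gamma>) ! i)"
      using v arr_i.prems(2) by (simp add: nth_Cons split: nat.split)
    with arr_i.prems(1) have "psubst (case_nat v \<sigma>) t \<in> interp \<rho> B" by (rule arr_i.IH)
    moreover have "whead (App (psubst \<sigma> (Lam t)) v) (psubst (case_nat v \<sigma>) t)"
      by (metis psubst.simps(3) subst_psubst_under_binder whead_beta)
    ultimately show ?thesis
      using saturated_interp[OF arr_i.prems(1)] by (blast intro: saturatedD)
  qed
  then show ?case by simp
next
  case (all_i \<Gamma> t A)
  have "psubst \<sigma> t \<in> interp (case_nat S \<rho>) A" if "saturated S" for S
  proof (rule all_i.IH)
    show "\<forall>i. saturated (case_nat S \<rho> i)"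
      using that all_i.prems(1) by (simp split: nat.split)
    show "\<forall>i < length (map (tlift 0) \<Gamma>). \<sigma> i \<in> interp (case_nat S \<rho>) (map (tlift 0) \<Gamma> ! i)"
      using all_i.prems(2) by simp
  qed
  then show ?case by simp
next
  case (all_e \<Gamma> t A G)
  have "psubst \<sigma> t \<in> interp \<rho> (All A)" using all_e.prems by (rule all_e.IH)
  \<comment> \<open>Hence the interpretation of \<open>G\<close> is itself one of the sets over
    which the quantifier ranges, although \<open>G\<close> is arbitrary.\<close>
  moreover have "saturated (interp \<rho> G)"
    using all_e.prems(1) by (rule saturated_interp)
  ultimately show ?case by (simp add: interp_tsubst_0)
qed simp_all

lemma Id_type_applied_Var:
  assumes "[] \<turnstile>\<^sub>F t : Id_type"
  shows "whead\<^sup>*\<^sup>* (App t (Var k)) (Var k)"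
proof -
  define S where "S = {s. whead\<^sup>*\<^sup>* s (Var k)}"
  have S: "saturated S"
    unfolding saturated_def S_def by (auto intro: converse_rtranclp_into_rtranclp)
  \<comment> \<open>With an empty context the condition on \<open>\<sigma>\<close> is vacuous; the
    choice \<open>Var\<close> gives back \<open>t\<close> itself.\<close>
  have "psubst Var t \<in> interp (\<lambda>_. S) Id_type"
    using assms S by (intro adequacy) auto
  with S have "\<forall>v \<in> S. App t v \<in> S"
    by (auto simp: Id_type_def)
  then show ?thesis by (auto simp: S_def)
qed

lemma beta_normal_Id_type:
  assumes closed: "closed_trm t" and normal: "beta_normal t" and typed: "[] \<turnstile>\<^sub>F t : Id_type"
  shows "t = Lam (Var 0)"
proof -
  have "whead\<^sup>*\<^sup>* (App t (Var 0)) (Var 0)"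
    using typed by (rule Id_type_applied_Var)
  \<comment> \<open>An application is not a variable, so the reduction has at least one
    step.\<close>
  then obtain s where step: "whead (App t (Var 0)) s" and rest: "whead\<^sup>*\<^sup>* s (Var 0)"
    by (cases rule: converse_rtranclpE) auto
  from step obtain u where t: "t = Lam u" and s: "s = subst 0 (Var 0) u"
  proof cases
    case (whead_App u')
    then show thesis using normal whead_imp_beta unfolding beta_normal_def by blast
  qed
  \<comment> \<open>As \<open>Lam u\<close> is closed, only the variable bound by this
    \<open>Lam\<close> can be free in \<open>u\<close>, and the contraction replaces it by
    \<open>Var 0\<close>.\<close>
  have "\<not> free_in i u" if "0 < i" for i
    using closed that t by (cases i) (auto simp: closed_trm_def)
  then have "s = u" using s by (simp add: subst_same_Var)
  \<comment> \<open>A step from \<open>u\<close> would be a \<beta>-step below the abstraction in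
    \<open>t\<close>, so the remaining reduction is empty.\<close>
  have "\<not> whead u u'" for u'
    using normal t whead_imp_beta beta.intros(4) unfolding beta_normal_def by blast
  with rest \<open>s = u\<close> have "u = Var 0"
    by (metis converse_rtranclpE)
  with t show ?thesis by simp
qed

lemma typing_identity: "[] \<turnstile>\<^sub>F Lam (Var 0) : Id_type"
proof -
  have "[TVar 0] \<turnstile>\<^sub>F Var 0 : TVar 0"
    using ax[of "[TVar 0]" 0] by simp
  then show ?thesis
    unfolding Id_type_def by (intro all_i arr_i) auto
qed

lemma beta_eta_normal_identity: "beta_eta_normal (Lam (Var 0))"
  unfolding beta_eta_normal_def by (auto elim: beta.cases eta.cases)

lemma Lambda_set_Id_type: "Lambda_set Id_type = {Lam (Var 0)}"
proof -
  have "closed_trm (Lam (Var 0))" by (simp add: closed_trm_def)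
  moreover have "beta_normal t" if "beta_eta_normal t" for t
    using that by (auto simp: beta_normal_def beta_eta_normal_def)
  ultimately show ?thesis
    using typing_identity beta_eta_normal_identity beta_normal_Id_type
    unfolding Lambda_set_def by blast
qed

lemma I_type_Id_type: "I_type Id_type"
proof -
  have "lambda_I (Lam (Var 0))" by (intro lambda_I.intros) simp
  then have "\<forall>t. closed_trm t \<and> beta_normal t \<and> ([] \<turnstile>\<^sub>F t : Id_type) \<longrightarrow> lambda_I t"
    using beta_normal_Id_type by blast
  moreover have "proper Id_type" "closed_ty Id_type"
    by (simp_all add: Id_type_def closed_ty_def)
  ultimately show ?thesis by (simp add: I_type_def)
qed

theorem mainTheorem2: "I_type_of_order Id_type 1"
  by (simp add: I_type_of_order_def I_type_Id_type Lambda_set_Id_type)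

end
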